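(* Let $p\ge 2$ be an integer, let $H_1$ be a single edge and $H_2$ a $p$-star, let $\beta_1,\beta_2$ be negative real numbers, and let $(\alpha_n)$ be a sequence of real numbers with $\alpha_n\to\infty$. Let $L_n$ and $Z_n$ be, respectively, the variational quantity and the partition function of the edge-$p$-star model with parameters $\alpha_n\beta_1,\alpha_n\beta_2$ (defined in the context). Then $$\lim_{n\to\infty}\frac{L_n}{e^{2\alpha_n\beta_1}}=\frac12.$$ If, in addition, $\lim_{n\to\infty}\frac{\alpha_n^{8/5}(\log n)^{1/5}e^{2\alpha_n|\beta_1|}}{n^{1/5}}=0$, then $$\lim_{n\to\infty}\frac{\log Z_n}{n^2e^{2\alpha_n\beta_1}}=\frac12.$$
   Context: A $p$-star is the graph with $p+1$ vertices consisting of one central vertex joined to $p$ other vertices (and no other edges). For a finite simple graph $H$ with $v(H)$ vertices and a simple graph $G_n$ on $\{1,\ldots,n\}$, the homomorphism density is $t(H,G_n)=|\mathrm{hom}(H,G_n)|/n^{v(H)}$, where $\mathrm{hom}(H,G_n)$ is the set of edge-preserving maps $V(H)\to V(G_n)$. The partition function is $$Z_n=\sum_{G_n}\exp\left[n^2\left(\alpha_n\beta_1t(H_1,G_n)+\alpha_n\beta_2t(H_2,G_n)\right)\right],$$ the sum being over all undirected simple graphs on $\{1,\ldots,n\}$. Let $\mathcal{P}_n=\{(x_{ij})_{1\le i<j\le n}: x_{ij}\in[0,1]\}$. For $x\in\mathcal{P}_n$, set $x_{ji}=x_{ij}$ for $i<j$ and $x_{ii}=0$. For a finite simple graph $H$ with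 vertex set $\{1,\ldots,v(H)\}$ and edge set $E(H)$, let $$t(H,x)=\frac{1}{n^{v(H)}}\sum_{q_1,\ldots,q_{v(H)}=1}^n\ \prod_{\{l,l'\}\in E(H)}x_{q_lq_{l'}},$$ and let $I(x)=\sum_{1\le i<j\le n}\left(x_{ij}\log x_{ij}+(1-x_{ij})\log(1-x_{ij})\right)$, with $0\log 0=0$. Define $$L_n=\sup_{x\in\mathcal{P}_n}\left\{\alpha_n\beta_1t(H_1,x)+\alpha_n\beta_2t(H_2,x)-\frac{I(x)}{n^2}\right\}.$$ *)

theory Defs
  imports Complex_Main "HOL-Library.FuncSet"
begin

text \<open>A finite simple graph has vertex set \<open>{1..nverts G}\<close>; its edges are two-element
  sets of vertices.\<close>

record fgraph =
  nverts :: nat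
  edges :: "nat set set"

definition simple_graph :: "fgraph \<Rightarrow> bool" where
  "simple_graph G \<longleftrightarrow> (\<forall>e\<in>edges G. e \<subseteq> {1..nverts G} \<and> card e = 2)"

definition graphs_on :: "nat \<Rightarrow> fgraph set" where
  "graphs_on n = {G. simple_graph G \<and> nverts G = n}"

definition edge_graph :: fgraph where
  "edge_graph = \<lparr>nverts = 2, edges = {{1, 2}}\<rparr>"

definition star_graph :: "nat \<Rightarrow> fgraph" where
  "star_graph p = \<lparr>nverts = p + 1, edges = {{1, l} | l. l \<in> {2..p + 1}}\<rparr>"

text \<open>Maps between vertex sets are taken in \<open>\<rightarrow>\<^sub>E\<close>, so that each of them
  is counted exactly once.\<close>

definition homs :: "fgraph \<Rightarrow> fgraph \<Rightarrow> (nat \<Rightarrow> nat) set" where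
  "homs H G = {f \<in> {1..nverts H} \<rightarrow>\<^sub>E {1..nverts G}.
     \<forall>l l'. {l, l'} \<in> edges H \<longrightarrow> {f l, f l'} \<in> edges G}"

definition hom_density :: "fgraph \<Rightarrow> fgraph \<Rightarrow> real" where
  "hom_density H G = real (card (homs H G)) / real (nverts G) ^ nverts H"

definition partition_fun :: "fgraph \<Rightarrow> fgraph \<Rightarrow> real \<Rightarrow> real \<Rightarrow> nat \<Rightarrow> real" where
  "partition_fun H1 H2 b1 b2 n =
     (\<Sum>G\<in>graphs_on n. exp (real n ^ 2 * (b1 * hom_density H1 G + b2 * hom_density H2 G)))"

text \<open>A point of the cube is a function of which only the values \<open>x i j\<close> with
  \<open>1 \<le> i < j \<le> n\<close> matter: everything below depends on \<open>x\<close> through these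
  coordinates alone.\<close>

definition pairs :: "nat \<Rightarrow> (nat \<times> nat) set" where
  "pairs n = {(i, j). 1 \<le> i \<and> i < j \<and> j \<le> n}"

definition cube :: "nat \<Rightarrow> (nat \<Rightarrow> nat \<Rightarrow> real) set" where
  "cube n = {x. \<forall>(i, j)\<in>pairs n. x i j \<in> {0..1}}"

definition sym_ext :: "(nat \<Rightarrow> nat \<Rightarrow> real) \<Rightarrow> nat \<Rightarrow> nat \<Rightarrow> real" where
  "sym_ext x i j = (if i < j then x i j else if j < i then x j i else 0)"

text \<open>The endpoints of an edge \<open>e\<close> are \<open>Min e\<close> and \<open>Max e\<close>; by symmetry of
  \<^const>\<open>sym_ext\<close> their order is immaterial.\<close>

definition weighted_density :: "fgraph \<Rightarrow> nat \<Rightarrow> (nat \<Rightarrow> nat \<Rightarrow> real) \<Rightarrow> real" where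
  "weighted_density H n x =
     (\<Sum>q\<in>{1..nverts H} \<rightarrow>\<^sub>E {1..n}. \<Prod>e\<in>edges H. sym_ext x (q (Min e)) (q (Max e)))
       / real n ^ nverts H"

text \<open>Since \<open>ln 0 = 0\<close> here, the convention \<open>0 log 0 = 0\<close> holds as written.\<close>

definition entropy_fun :: "nat \<Rightarrow> (nat \<Rightarrow> nat \<Rightarrow> real) \<Rightarrow> real" where
  "entropy_fun n x =
     (\<Sum>(i, j)\<in>pairs n. x i j * ln (x i j) + (1 - x i j) * ln (1 - x i j))"

definition variational_objective ::
    "fgraph \<Rightarrow> fgraph \<Rightarrow> real \<Rightarrow> real \<Rightarrow> nat \<Rightarrow> (nat \<Rightarrow> nat \<Rightarrow> real) \<Rightarrow> real" where
  "variational_objective H1 H2 b1 b2 n x =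
     b1 * weighted_density H1 n x + b2 * weighted_density H2 n x - entropy_fun n x / real n ^ 2"

definition variational_sup :: "fgraph \<Rightarrow> fgraph \<Rightarrow> real \<Rightarrow> real \<Rightarrow> nat \<Rightarrow> real" where
  "variational_sup H1 H2 b1 b2 n = (SUP x\<in>cube n. variational_objective H1 H2 b1 b2 n x)"

text \<open>The remaining facts show that the definitions are not degenerate: the sum in
  \<^const>\<open>partition_fun\<close> is finite, and the supremum is over a nonempty set bounded above.\<close>

lemma simple_graph_edge_graph: "simple_graph edge_graph"
  by (auto simp: simple_graph_def edge_graph_def)

lemma simple_graph_star_graph: "simple_graph (star_graph p)"
  by (auto simp: simple_graph_def star_graph_def)

lemma finite_graphs_on: "finite (graphs_on n)"
proof -
  have "graphs_on n \<subseteq> (\<lambda>E. \<lparr>nverts = n, edges = E\<rparr>) ` Pow (Pow {1..n})"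
  proof
    fix G assume G: "G \<in> graphs_on n"
    then have "G = \<lparr>nverts = n, edges = edges G\<rparr>" "edges G \<in> Pow (Pow {1..n})"
      by (cases G; auto simp: graphs_on_def simple_graph_def)+
    then show "G \<in> (\<lambda>E. \<lparr>nverts = n, edges = E\<rparr>) ` Pow (Pow {1..n})"
      by blast
  qed
  then show ?thesis
    by (rule finite_subset) simp
qed

lemma sym_ext_bounds:
  assumes "x \<in> cube n" "i \<in> {1..n}" "j \<in> {1..n}"
  shows "0 \<le> sym_ext x i j" "sym_ext x i j \<le> 1"
  using assms by (auto simp: sym_ext_def cube_def pairs_def)

lemma weighted_density_bounds:
  assumes "simple_graph H" "x \<in> cube n"
  shows "0 \<le> weighted_density H n x" "weighted_density H n x \<le> 1"
proof -
  let ?Q = "{1..nverts H} \<rightarrow>\<^sub>E {1..n}"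
  let ?P = "\<lambda>q. \<Prod>e\<in>edges H. sym_ext x (q (Min e)) (q (Max e))"
  have ends: "q (Min e) \<in> {1..n}" "q (Max e) \<in> {1..n}" if "q \<in> ?Q" "e \<in> edges H" for q e
  proof -
    have "e \<subseteq> {1..nverts H}" "card e = 2"
      using assms(1) that(2) by (auto simp: simple_graph_def)
    moreover from this have "finite e" "e \<noteq> {}"
      using finite_subset by auto
    ultimately have "Min e \<in> {1..nverts H}" "Max e \<in> {1..nverts H}"
      using Min_in Max_in by blast+
    then show "q (Min e) \<in> {1..n}" "q (Max e) \<in> {1..n}"
      using that(1) by (auto simp: PiE_def Pi_def)
  qed
  have P: "0 \<le> ?P q" "?P q \<le> 1" if "q \<in> ?Q" for q
    using ends[OF that] sym_ext_bounds[OF assms(2)]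
    by (auto intro!: prod_nonneg prod_le_1)
  then show "0 \<le> weighted_density H n x"
    unfolding weighted_density_def by (intro divide_nonneg_nonneg sum_nonneg) auto
  have "sum ?P ?Q \<le> (\<Sum>q\<in>?Q. 1)"
    by (rule sum_mono) (use P in auto)
  also have "\<dots> = real n ^ nverts H"
    by (simp add: card_PiE)
  finally show "weighted_density H n x \<le> 1"
    unfolding weighted_density_def by (auto simp: divide_le_eq)
qed

lemma x_ln_x_ge:
  assumes "0 \<le> x" 
  shows "- 1 \<le> x * ln (x::real)"
proof (cases "x = 0")
  case False
  then have x: "x > 0" using assms by simp
  have "ln (1 / x) \<le> 1 / x - 1"
    using x by (intro ln_le_minus_one) simp
  then have "x * (- ln x) \<le> x * (1 / x - 1)"
    using x by (intro mult_left_mono) (auto simp: ln_div)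
  also have "\<dots> = 1 - x"
    using x by (simp add: field_simps)
  finally show ?thesis using x by simp
qed simp

lemma cube_nonempty: "cube n \<noteq> {}"
proof -
  have "(\<lambda>_ _. 0) \<in> cube n" by (auto simp: cube_def)
  then show ?thesis by blast
qed

lemma bdd_above_variational_objective:
  assumes "simple_graph H1" "simple_graph H2"
  shows "bdd_above (variational_objective H1 H2 b1 b2 n ` cube n)"
proof (rule bdd_aboveI2)
  fix x assume x: "x \<in> cube n"
  have A: "b * weighted_density H n x \<le> \<bar>b\<bar>" if "simple_graph H" for b H
  proof -
    have "b * weighted_density H n x \<le> \<bar>b\<bar> * weighted_density H n x"
      using weighted_density_bounds[OF that x] by (intro mult_right_mono) auto
    also have "\<dots> \<le> \<bar>b\<bar> * 1"
      using weighted_density_bounds[OF that x] by (intro mult_left_mono) auto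
    finally show ?thesis by simp
  qed
  have "(\<Sum>(i, j)\<in>pairs n. - 2) \<le> entropy_fun n x"
    unfolding entropy_fun_def
  proof (rule sum_mono, clarify)
    fix i j assume "(i, j) \<in> pairs n"
    then have "0 \<le> x i j" "0 \<le> 1 - x i j"
      using x by (auto simp: cube_def)
    from x_ln_x_ge[OF this(1)] x_ln_x_ge[OF this(2)]
    show "- 2 \<le> x i j * ln (x i j) + (1 - x i j) * ln (1 - x i j)" by linarith
  qed
  then have "(\<Sum>(i, j)\<in>pairs n. - 2) / real n ^ 2 \<le> entropy_fun n x / real n ^ 2"
    by (rule divide_right_mono) simp
  with A[OF assms(1), of b1] A[OF assms(2), of b2]
  show "variational_objective H1 H2 b1 b2 n x
      \<le> \<bar>b1\<bar> + \<bar>b2\<bar> - (\<Sum>(i, j)\<in>pairs n. - 2) / real n ^ 2"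
    unfolding variational_objective_def by linarith
qed

end

theory Submission
  imports Defs "HOL-Real_Asymp.Real_Asymp"
begin

text \<open>Put \<open>z = exp (2 * \<alpha> * \<beta>1)\<close>. Dropping the star term, which has a negative coefficient,
  leaves independent edges of weight \<open>z\<close>, so \<open>ln Z \<le> (n choose 2) * ln (1 + z)\<close>, and
  likewise the variational problem decouples into one-dimensional ones with value
  \<open>ln (1 + z) \<le> z\<close>. For the lower bounds, take the constant point \<open>z / (1 + z)\<close> in the
  variational problem, and apply Jensen's inequality to \<open>Z\<close> under the law of independent edges.
  Then the mean star density is at most \<open>z\<^sup>2\<close>, respectively \<open>z\<^sup>2 + z / n\<close>, which costs a relative
  error \<open>\<alpha> * z\<close>, respectively \<open>\<alpha> * z + \<alpha> / n\<close>, and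
  the growth condition forces \<open>\<alpha> / n \<longlonglongrightarrow> 0\<close>.\<close>

section \<open>Vertex pairs and double sums over vertices\<close>

lemma finite_pairs: "finite (pairs n)"
  by (rule finite_subset[of _ "{1..n} \<times> {1..n}"]) (auto simp: pairs_def)

text \<open>The edge set of the complete graph. Graphs on n vertices correspond to its subsets,
  while the cube is indexed by the ordered version \<open>pairs n\<close>.\<close>

definition vertex_pairs :: "nat \<Rightarrow> nat set set" where
  "vertex_pairs n = {e. e \<subseteq> {1..n} \<and> card e = 2}"

lemma finite_vertex_pairs: "finite (vertex_pairs n)"
  by (rule finite_subset[of _ "Pow {1..n}"]) (auto simp: vertex_pairs_def)

lemma card_vertex_pairs: "card (vertex_pairs n) = n choose 2"
  unfolding vertex_pairs_def using n_subsets[of "{1..n}" 2] by simp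

lemma real_choose_two: "real (n choose 2) = real n * (real n - 1) / 2"
  by (cases n) (simp_all add: choose_two real_of_nat_div algebra_simps)

lemma bij_betw_pairs_vertex_pairs:
  "bij_betw (\<lambda>(i, j). {i, j}) (pairs n) (vertex_pairs n)"
  unfolding bij_betw_def
proof
  show "inj_on (\<lambda>(i, j). {i, j}) (pairs n)"
    by (auto simp: inj_on_def pairs_def doubleton_eq_iff)
  show "(\<lambda>(i, j). {i, j}) ` pairs n = vertex_pairs n"
  proof
    show "(\<lambda>(i, j). {i, j}) ` pairs n \<subseteq> vertex_pairs n"
      by (auto simp: pairs_def vertex_pairs_def)
    show "vertex_pairs n \<subseteq> (\<lambda>(i, j). {i, j}) ` pairs n"
    proof
      fix e assume e: "e \<in> vertex_pairs n"
      then obtain a b where ab: "e = {a, b}" "a \<noteq> b"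
        by (auto simp: vertex_pairs_def card_2_iff)
      have "(min a b, max a b) \<in> pairs n"
        using e ab by (auto simp: vertex_pairs_def pairs_def)
      moreover have "e = (\<lambda>(i, j). {i, j}) (min a b, max a b)"
        using ab by (auto simp: min_def max_def)
      ultimately show "e \<in> (\<lambda>(i, j). {i, j}) ` pairs n" by blast
    qed
  qed
qed

lemma card_pairs: "card (pairs n) = n choose 2"
  using bij_betw_same_card[OF bij_betw_pairs_vertex_pairs] card_vertex_pairs by metis

text \<open>The square splits into \<open>pairs n\<close>, its mirror image and the diagonal; the
  first two contribute equally and the diagonal nothing.\<close>

lemma sum_symmetric:
  fixes f :: "nat \<Rightarrow> nat \<Rightarrow> real"
  assumes sym: "\<And>a b. f a b = f b a" and diag: "\<And>a. f a a = 0"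
  shows "(\<Sum>a\<in>{1..n}. \<Sum>b\<in>{1..n}. f a b) = 2 * (\<Sum>(i, j)\<in>pairs n. f i j)"
proof -
  let ?D = "(\<lambda>a. (a, a)) ` {1..n}" and ?S = "prod.swap ` pairs n"
  have split: "{1..n} \<times> {1..n} = (pairs n \<union> ?S) \<union> ?D"
  proof (intro equalityI subsetI)
    fix z assume "z \<in> {1..n} \<times> {1..n}"
    then obtain a b where z: "z = (a, b)" "a \<in> {1..n}" "b \<in> {1..n}" by blast
    consider "a < b" | "b < a" | "a = b" by linarith
    then show "z \<in> (pairs n \<union> ?S) \<union> ?D"
    proof cases
      case 2
      then have "(b, a) \<in> pairs n" using z by (auto simp: pairs_def)
      then show ?thesis using z(1) by force
    qed (use z in \<open>auto simp: pairs_def\<close>)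
  qed (auto simp: pairs_def)
  have "(\<Sum>a\<in>{1..n}. \<Sum>b\<in>{1..n}. f a b) = (\<Sum>(a, b)\<in>{1..n} \<times> {1..n}. f a b)"
    by (rule sum.cartesian_product)
  also have "\<dots> = (\<Sum>(a, b)\<in>pairs n \<union> ?S. f a b) + (\<Sum>(a, b)\<in>?D. f a b)"
    unfolding split by (intro sum.union_disjoint finite_UnI finite_imageI finite_pairs finite_atLeastAtMost)
      (auto simp: pairs_def)
  also have "(\<Sum>(a, b)\<in>?D. f a b) = 0"
    by (rule sum.neutral) (auto simp: diag)
  also have "(\<Sum>(a, b)\<in>pairs n \<union> ?S. f a b)
      = (\<Sum>(a, b)\<in>pairs n. f a b) + (\<Sum>(a, b)\<in>?S. f a b)"
    by (intro sum.union_disjoint finite_UnI finite_imageI finite_pairs finite_atLeastAtMost)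
      (auto simp: pairs_def)
  also have "(\<Sum>(a, b)\<in>?S. f a b) = (\<Sum>(a, b)\<in>pairs n. f a b)"
    by (subst sum.reindex) (auto simp: case_prod_unfold intro!: sum.cong sym)
  finally show ?thesis by simp
qed

text \<open>Rewrites sums over the vertex maps of a single edge as double sums, to which
  \<open>sum_symmetric\<close> applies.\<close>

lemma sum_PiE_two:
  fixes f :: "nat \<Rightarrow> nat \<Rightarrow> real"
  shows "(\<Sum>q\<in>{1..2::nat} \<rightarrow>\<^sub>E A. f (q 1) (q 2)) = (\<Sum>a\<in>A. \<Sum>b\<in>A. f a b)"
proof -
  have two: "{1..2::nat} = {1, 2::nat}" by auto
  have "(\<Sum>q\<in>{1..2::nat} \<rightarrow>\<^sub>E A. f (q 1) (q 2)) = (\<Sum>(a, b)\<in>A \<times> A. f a b)"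
    unfolding two
    by (rule sum.reindex_bij_witness[of _ "\<lambda>(a, b). \<lambda>l\<in>{1, 2}. if l = 1 then a else b"
          "\<lambda>q. (q 1, q 2)"])
       (auto simp: PiE_def extensional_def fun_eq_iff)
  then show ?thesis by (simp add: sum.cartesian_product)
qed

section \<open>Weighted densities of the edge, the star and constant points\<close>

lemma weighted_density_edge:
  "weighted_density edge_graph n x = 2 * (\<Sum>(i, j)\<in>pairs n. x i j) / real n ^ 2"
proof -
  have "(\<Sum>q\<in>{1..2::nat} \<rightarrow>\<^sub>E {1..n}. sym_ext x (q 1) (q 2))
      = 2 * (\<Sum>(i, j)\<in>pairs n. sym_ext x i j)"
    unfolding sum_PiE_two by (rule sum_symmetric) (auto simp: sym_ext_def)
  also have "(\<Sum>(i, j)\<in>pairs n. sym_ext x i j) = (\<Sum>(i, j)\<in>pairs n. x i j)"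
    by (rule sum.cong) (auto simp: pairs_def sym_ext_def)
  finally show ?thesis
    by (simp add: weighted_density_def edge_graph_def numeral_2_eq_2)
qed

lemma edges_star_graph: "edges (star_graph p) = (\<lambda>l. {1, l}) ` {2..p + 1}"
  by (auto simp: star_graph_def)

lemma card_edges_star_graph: "card (edges (star_graph p)) = p"
  unfolding edges_star_graph
  by (subst card_image) (auto simp: inj_on_def doubleton_eq_iff)

text \<open>Each factor is \<open>u\<close>, or 0 when the map collapses an edge, because
  \<open>sym_ext\<close> vanishes on the diagonal; hence an inequality.\<close>

lemma weighted_density_const_le:
  assumes "0 \<le> u"
  shows "weighted_density H n (\<lambda>_ _. u) \<le> u ^ card (edges H)"
proof -
  have "(\<Sum>q\<in>{1..nverts H} \<rightarrow>\<^sub>E {1..n}.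
            \<Prod>e\<in>edges H. sym_ext (\<lambda>_ _. u) (q (Min e)) (q (Max e)))
      \<le> (\<Sum>q\<in>{1..nverts H} \<rightarrow>\<^sub>E {1..n}. \<Prod>e\<in>edges H. u)"
    by (intro sum_mono prod_mono) (use assms in \<open>auto simp: sym_ext_def\<close>)
  also have "\<dots> = u ^ card (edges H) * real n ^ nverts H"
    by (simp add: card_PiE)
  finally have "weighted_density H n (\<lambda>_ _. u)
      \<le> u ^ card (edges H) * real n ^ nverts H / real n ^ nverts H"
    unfolding weighted_density_def by (rule divide_right_mono) simp
  also have "\<dots> \<le> u ^ card (edges H)"
    using assms by (cases "real n ^ nverts H = 0") auto
  finally show ?thesis .
qed

section \<open>The variational problem\<close>

text \<open>The edge density is linear in the coordinates, so together with the entropy it decouples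
  over pairs; only the second graph couples them.\<close>

lemma variational_objective_edge:
  "variational_objective edge_graph H b1 b2 n x =
     (\<Sum>(i, j)\<in>pairs n. 2 * b1 * x i j - (x i j * ln (x i j) + (1 - x i j) * ln (1 - x i j)))
       / real n ^ 2 + b2 * weighted_density H n x"
  unfolding variational_objective_def weighted_density_edge entropy_fun_def
  by (simp add: case_prod_unfold sum_subtractf sum_distrib_left[symmetric] diff_divide_distrib
      mult.assoc)

text \<open>This is \<open>ln t \<le> t - 1\<close> at \<open>t = c / a\<close>, multiplied by
  \<open>a\<close>.\<close>

lemma mult_ln_diff_le:
  fixes a c :: real
  assumes "0 \<le> a" "0 < c"
  shows "a * (ln c - ln a) \<le> c - a"
proof (cases "a = 0")
  case False
  with assms have a: "0 < a" by simp
  have "ln c - ln a \<le> c / a - 1"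
    using ln_le_minus_one[of "c / a"] a assms by (simp add: ln_div)
  then have "a * (ln c - ln a) \<le> a * (c / a - 1)"
    using a by (intro mult_left_mono) auto
  then show ?thesis using a by (simp add: algebra_simps)
qed (use assms in auto)

text \<open>The previous bound with \<open>c = exp b\<close> at \<open>x\<close> and with
  \<open>c = 1\<close> at \<open>1 - x\<close> gives \<open>exp b - x\<close> and \<open>x\<close>,
  which add up to \<open>exp b\<close>.\<close>

lemma tilted_entropy_le:
  fixes x b :: real
  assumes "0 \<le> x" "x \<le> 1"
  shows "b * x - (x * ln x + (1 - x) * ln (1 - x)) \<le> exp b"
  using mult_ln_diff_le[of x "exp b"] mult_ln_diff_le[of "1 - x" 1] assms
  by (simp add: algebra_simps)

text \<open>Here \<open>u\<close> is the Bernoulli parameter with odds \<open>exp b\<close>: both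
  logarithms contain \<open>- ln (1 + exp b)\<close>, with total weight 1, and the linear terms
  cancel.\<close>

lemma tilted_entropy_max:
  fixes b :: real
  defines "u \<equiv> exp b / (1 + exp b)"
  shows "b * u - (u * ln u + (1 - u) * ln (1 - u)) = ln (1 + exp b)"
proof -
  have p: "0 < 1 + exp b" by (simp add: add_pos_pos)
  have "1 - u = 1 / (1 + exp b)"
    unfolding u_def using p by (simp add: field_simps)
  then have l: "ln (1 - u) = - ln (1 + exp b)"
    using p by (simp add: ln_div)
  have lu: "ln u = b - ln (1 + exp b)"
    unfolding u_def using p by (simp add: ln_div)
  show ?thesis unfolding l lu by (simp add: algebra_simps)
qed

lemma variational_sup_edge_le:
  assumes "simple_graph H" "b2 \<le> 0"
  shows "variational_sup edge_graph H b1 b2 n \<le> exp (2 * b1) / 2"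
  unfolding variational_sup_def
proof (rule cSUP_least[OF cube_nonempty])
  fix x assume x: "x \<in> cube n"
  have "(\<Sum>(i, j)\<in>pairs n. 2 * b1 * x i j - (x i j * ln (x i j) + (1 - x i j) * ln (1 - x i j)))
      \<le> (\<Sum>(i, j)\<in>pairs n. exp (2 * b1))"
    by (rule sum_mono) (use x in \<open>auto simp: cube_def intro!: tilted_entropy_le\<close>)
  also have "\<dots> = real n * (real n - 1) / 2 * exp (2 * b1)"
    by (simp add: card_pairs real_choose_two)
  also have "\<dots> \<le> real n ^ 2 / 2 * exp (2 * b1)"
    by (intro mult_right_mono) (auto simp: power2_eq_square algebra_simps)
  finally have "(\<Sum>(i, j)\<in>pairs n. 2 * b1 * x i j
        - (x i j * ln (x i j) + (1 - x i j) * ln (1 - x i j))) / real n ^ 2 \<le> exp (2 * b1) / 2"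
    \<comment> \<open>For \<open>n = 0\<close> the quotient is 0 by the convention for
      division.\<close>
    by (cases "n = 0") (auto simp: divide_le_eq mult_ac)
  moreover have "b2 * weighted_density H n x \<le> 0"
    using assms weighted_density_bounds[OF assms(1) x] by (simp add: mult_nonpos_nonneg)
  ultimately show "variational_objective edge_graph H b1 b2 n x \<le> exp (2 * b1) / 2"
    unfolding variational_objective_edge by linarith
qed

text \<open>The constant point \<open>u\<close> attains the decoupled optimum in every coordinate.
  Its density in \<open>H\<close> is at most \<open>u ^ 2\<close>, since \<open>u \<le> 1\<close>
  and \<open>H\<close> has at least two edges, and \<open>u \<le> exp (2 * b1)\<close>.\<close>

lemma variational_sup_edge_ge:
  assumes H: "simple_graph H" "card (edges H) \<ge> 2" and b2: "b2 \<le> 0"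
  shows "real (n choose 2) / real n ^ 2 * ln (1 + exp (2 * b1)) + b2 * exp (2 * b1) ^ 2
      \<le> variational_sup edge_graph H b1 b2 n"
proof -
  define u where "u = exp (2 * b1) / (1 + exp (2 * b1))"
  have p: "0 < 1 + exp (2 * b1)" by (simp add: add_pos_pos)
  have u: "0 \<le> u" "u \<le> 1" "u \<le> exp (2 * b1)"
    unfolding u_def using p by (auto simp: divide_le_eq algebra_simps)
  have "weighted_density H n (\<lambda>_ _. u) \<le> u ^ card (edges H)"
    by (rule weighted_density_const_le) (use u in simp)
  also have "\<dots> \<le> u ^ 2"
    using u H by (intro power_decreasing) auto
  also have "\<dots> \<le> exp (2 * b1) ^ 2"
    using u by (intro power_mono) auto
  finally have "b2 * exp (2 * b1) ^ 2 \<le> b2 * weighted_density H n (\<lambda>_ _. u)"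
    using b2 by (rule mult_left_mono_neg)
  then have "real (n choose 2) / real n ^ 2 * ln (1 + exp (2 * b1)) + b2 * exp (2 * b1) ^ 2
      \<le> variational_objective edge_graph H b1 b2 n (\<lambda>_ _. u)"
    unfolding variational_objective_edge
    by (simp only: u_def tilted_entropy_max) (simp add: card_pairs)
  also have "\<dots> \<le> variational_sup edge_graph H b1 b2 n"
    unfolding variational_sup_def
    by (rule cSUP_upper[OF _ bdd_above_variational_objective[OF simple_graph_edge_graph H(1)]])
      (use u in \<open>auto simp: cube_def\<close>)
  finally show ?thesis .
qed

section \<open>Weighted sums over edge sets, and the upper bound for the partition function\<close>

lemma sum_power_card_Pow:
  fixes z :: "'a :: comm_semiring_1"
  assumes "finite A"
  shows "(\<Sum>E\<in>Pow A. z ^ card E) = (1 + z) ^ card A"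
  using prod_add[OF assms, of "\<lambda>_. z" "\<lambda>_. 1"] by (simp add: add.commute)

text \<open>Removing \<open>S\<close> maps its supersets in \<open>A\<close> bijectively onto the
  subsets of \<open>A - S\<close>. After division by \<open>(1 + z) ^ card A\<close>: if elements
  are chosen independently with odds \<open>z\<close>, all of \<open>S\<close> is present with
  probability at most \<open>z ^ card S\<close>.\<close>

lemma sum_power_card_supersets_le:
  fixes z :: real
  assumes A: "finite A" and z: "0 \<le> z"
  shows "(\<Sum>E\<in>{E\<in>Pow A. S \<subseteq> E}. z ^ card E) \<le> z ^ card S * (1 + z) ^ card A"
proof (cases "S \<subseteq> A")
  case True
  have fS: "finite S" using A True finite_subset by blast
  have "(\<Sum>E\<in>{E\<in>Pow A. S \<subseteq> E}. z ^ card E) = (\<Sum>F\<in>Pow (A - S). z ^ card S * z ^ card F)"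
  proof (rule sum.reindex_bij_witness[of _ "\<lambda>F. F \<union> S" "\<lambda>E. E - S"])
    fix E assume "E \<in> {E\<in>Pow A. S \<subseteq> E}"
    then have "S \<subseteq> E" "finite E" using A finite_subset by auto
    then show "z ^ card S * z ^ card (E - S) = z ^ card E"
      by (simp add: power_add[symmetric] card_Diff_subset[OF fS] card_mono)
  qed (use True in auto)
  also have "\<dots> = z ^ card S * (1 + z) ^ card (A - S)"
    using A by (simp add: sum_distrib_left[symmetric] sum_power_card_Pow)
  also have "\<dots> \<le> z ^ card S * (1 + z) ^ card A"
    using z A by (intro mult_left_mono power_increasing card_mono) auto
  finally show ?thesis .
next
  case False
  then have "{E\<in>Pow A. S \<subseteq> E} = {}" by auto
  moreover have "0 \<le> z ^ card S * (1 + z) ^ card A" using z by simp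
  ultimately show ?thesis by (simp only: sum.empty)
qed

lemma bij_betw_edges_graphs_on: "bij_betw edges (graphs_on n) (Pow (vertex_pairs n))"
  unfolding bij_betw_def
proof
  show "inj_on edges (graphs_on n)"
    by (auto simp: inj_on_def graphs_on_def)
  have "E \<in> edges ` graphs_on n" if "E \<in> Pow (vertex_pairs n)" for E
    using that by (intro image_eqI[of _ _ "\<lparr>nverts = n, edges = E\<rparr>"])
      (auto simp: graphs_on_def simple_graph_def vertex_pairs_def)
  then show "edges ` graphs_on n = Pow (vertex_pairs n)"
    by (auto simp: graphs_on_def simple_graph_def vertex_pairs_def)
qed

lemma sum_graphs_on:
  "(\<Sum>G\<in>graphs_on n. f (edges G)) = (\<Sum>E\<in>Pow (vertex_pairs n). f E)"
  by (rule sum.reindex_bij_betw[OF bij_betw_edges_graphs_on])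

lemma hom_density_nonneg: "0 \<le> hom_density H G"
  by (simp add: hom_density_def)

text \<open>A homomorphism from the single edge is an edge of \<open>G\<close> with an orientation,
  so each edge counts twice.\<close>

lemma hom_density_edge:
  assumes G: "G \<in> graphs_on n" and n: "n > 0"
  shows "real n ^ 2 * hom_density edge_graph G = 2 * real (card (edges G))"
proof -
  let ?f = "\<lambda>a b. of_bool ({a, b} \<in> edges G) :: real"
  have E: "edges G \<subseteq> vertex_pairs n" "nverts G = n"
    using G by (auto simp: graphs_on_def simple_graph_def vertex_pairs_def)
  have loop: "{a} \<notin> edges G" for a
    using E by (auto simp: vertex_pairs_def)
  have "homs edge_graph G = {q \<in> {1..2::nat} \<rightarrow>\<^sub>E {1..n}. {q 1, q 2} \<in> edges G}"
    by (auto simp: homs_def edge_graph_def E doubleton_eq_iff insert_commute)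
  then have "real (card (homs edge_graph G)) = (\<Sum>q\<in>{1..2::nat} \<rightarrow>\<^sub>E {1..n}. ?f (q 1) (q 2))"
    by (simp add: sum_of_bool_eq finite_PiE Int_def)
  also have "\<dots> = 2 * (\<Sum>(i, j)\<in>pairs n. ?f i j)"
    unfolding sum_PiE_two[of ?f]
    by (rule sum_symmetric) (auto simp: insert_commute loop)
  also have "(\<Sum>(i, j)\<in>pairs n. ?f i j) = (\<Sum>e\<in>vertex_pairs n. of_bool (e \<in> edges G))"
    using sum.reindex_bij_betw[OF bij_betw_pairs_vertex_pairs,
        of "\<lambda>e. of_bool (e \<in> edges G) :: real" n]
    by (simp add: case_prod_unfold)
  also have "\<dots> = real (card (edges G))"
    using E by (simp add: sum_of_bool_eq finite_vertex_pairs Int_absorb1)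
  finally show ?thesis
    using n by (simp add: hom_density_def E edge_graph_def)
qed

text \<open>The edge term becomes the weight \<open>z ^ card (edges G)\<close> with
  \<open>z = exp (2 * b1)\<close>, the unnormalised law of independent edges with odds
  \<open>z\<close>; the second graph enters as a factor to be averaged.\<close>

lemma partition_fun_edge:
  assumes "n > 0"
  shows "partition_fun edge_graph H b1 b2 n =
    (\<Sum>G\<in>graphs_on n. exp (2 * b1) ^ card (edges G) * exp (b2 * (real n ^ 2 * hom_density H G)))"
  unfolding partition_fun_def
proof (rule sum.cong)
  fix G assume G: "G \<in> graphs_on n"
  have "real n ^ 2 * (b1 * hom_density edge_graph G + b2 * hom_density H G)
      = b1 * (real n ^ 2 * hom_density edge_graph G) + b2 * (real n ^ 2 * hom_density H G)"
    by (simp add: algebra_simps)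
  then show "exp (real n ^ 2 * (b1 * hom_density edge_graph G + b2 * hom_density H G))
      = exp (2 * b1) ^ card (edges G) * exp (b2 * (real n ^ 2 * hom_density H G))"
    unfolding hom_density_edge[OF G assms]
    by (simp add: exp_add exp_of_nat_mult[symmetric] mult_ac)
qed simp

lemma sum_graphs_on_power_card:
  fixes z :: "'a :: comm_semiring_1"
  shows "(\<Sum>G\<in>graphs_on n. z ^ card (edges G)) = (1 + z) ^ (n choose 2)"
  using sum_graphs_on[of "\<lambda>E. z ^ card E" n]
  by (simp add: sum_power_card_Pow finite_vertex_pairs card_vertex_pairs)

lemma graphs_on_nonempty: "graphs_on n \<noteq> {}"
  using bij_betw_edges_graphs_on[of n] by (auto simp: bij_betw_def)

lemma partition_fun_pos: "0 < partition_fun H1 H2 b1 b2 n"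
  unfolding partition_fun_def
  by (rule sum_pos) (auto simp: finite_graphs_on graphs_on_nonempty)

lemma ln_partition_fun_edge_le:
  assumes "n > 0" "b2 \<le> 0"
  shows "ln (partition_fun edge_graph H b1 b2 n) \<le> real n ^ 2 * exp (2 * b1) / 2"
proof -
  have "partition_fun edge_graph H b1 b2 n \<le> (\<Sum>G\<in>graphs_on n. exp (2 * b1) ^ card (edges G))"
    unfolding partition_fun_edge[OF assms(1)]
    by (intro sum_mono mult_left_le)
      (use assms hom_density_nonneg[of H] in \<open>simp_all add: mult_nonpos_nonneg\<close>)
  then have "ln (partition_fun edge_graph H b1 b2 n) \<le> ln ((1 + exp (2 * b1)) ^ (n choose 2))"
    unfolding sum_graphs_on_power_card using partition_fun_pos by (simp add: ln_mono)
  also have "\<dots> = real (n choose 2) * ln (1 + exp (2 * b1))"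
    by (rule ln_realpow)
  also have "\<dots> \<le> real (n choose 2) * exp (2 * b1)"
    by (intro mult_left_mono ln_add_one_self_le_self) auto
  also have "\<dots> \<le> real n ^ 2 / 2 * exp (2 * b1)"
    by (intro mult_right_mono) (auto simp: real_choose_two power2_eq_square algebra_simps)
  finally show ?thesis by simp
qed

section \<open>The mean star count and the lower bound for the partition function\<close>

text \<open>Forgetting the value at 3 is injective on these maps, as it is repeated at 2. Since
  \<open>p \<ge> 2\<close>, the index 3 lies in the domain and \<open>p\<close> indices
  remain.\<close>

lemma card_PiE_two_equal_le:
  assumes "2 \<le> p"
  shows "card {q \<in> {1..p + 1} \<rightarrow>\<^sub>E {1..n::nat}. q 2 = q (3::nat)} \<le> n ^ p"
proof -
  let ?I = "{1..p + 1} - {3::nat}"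
  have "card {q \<in> {1..p + 1} \<rightarrow>\<^sub>E {1..n::nat}. q 2 = q 3} \<le> card (?I \<rightarrow>\<^sub>E {1..n})"
  proof (rule card_inj_on_le[of "\<lambda>q. restrict q ?I"])
    show "inj_on (\<lambda>q. restrict q ?I) {q \<in> {1..p + 1} \<rightarrow>\<^sub>E {1..n}. q 2 = q 3}"
    proof (rule inj_onI, rule ext)
      fix q r l
      assume q: "q \<in> {q \<in> {1..p + 1} \<rightarrow>\<^sub>E {1..n}. q 2 = q 3}"
        and r: "r \<in> {q \<in> {1..p + 1} \<rightarrow>\<^sub>E {1..n}. q 2 = q 3}"
        and eq: "restrict q ?I = restrict r ?I"
      have *: "q k = r k" if "k \<in> ?I" for k
        using that eq by (metis restrict_apply')
      show "q l = r l"
      proof (cases "l \<in> {1..p + 1}")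
        case True
        then show ?thesis using *[of l] *[of 2] q r assms by (cases "l = 3") auto
      next
        case False
        then show ?thesis using q r by (auto simp: PiE_def extensional_def)
      qed
    qed
    show "(\<lambda>q. restrict q ?I) ` {q \<in> {1..p + 1} \<rightarrow>\<^sub>E {1..n}. q 2 = q 3} \<subseteq> ?I \<rightarrow>\<^sub>E {1..n}"
      by (intro image_subsetI, rule restrict_PiE_iff[THEN iffD2]) (auto simp del: One_nat_def)
  qed (auto intro!: finite_PiE)
  also have "\<dots> = n ^ p"
    using assms by (simp add: card_PiE)
  finally show ?thesis .
qed

text \<open>Only the two edges at the leaves 2 and 3 are used; they map to distinct vertex pairs
  unless both leaves have the same image.\<close>

lemma sum_power_card_homs_star_le:
  fixes z :: real
  assumes p: "2 \<le> p" and z: "0 \<le> z"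
  shows "(\<Sum>G\<in>graphs_on n. z ^ card (edges G) * real (card (homs (star_graph p) G)))
      \<le> (1 + z) ^ (n choose 2) * (real n ^ (p + 1) * z ^ 2 + real n ^ p * z)"
proof -
  let ?Q = "{1..p + 1} \<rightarrow>\<^sub>E {1..n}" and ?V = "vertex_pairs n"
  define S where "S q = {{q 1, q 2}, {q 1, q 3}}" for q :: "nat \<Rightarrow> nat"
  \<comment> \<open>\<open>S q\<close> has one element if \<open>q 2 = q 3\<close> and two
    otherwise, so \<open>w q\<close> dominates \<open>z ^ card (S q)\<close>. Keeping
    \<open>z ^ 2\<close> in both cases lets it be summed over all of \<open>?Q\<close>.\<close>
  define w where "w q = z ^ 2 + (if q 2 = q 3 then z else 0)" for q :: "nat \<Rightarrow> nat"
  have fQ: "finite ?Q" by (intro finite_PiE) auto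
  have homs: "card (homs (star_graph p) G) \<le> card {q \<in> ?Q. S q \<subseteq> edges G}"
    if "G \<in> graphs_on n" for G
  proof (rule card_mono)
    have e: "{1, 2} \<in> edges (star_graph p)" "{1, 3} \<in> edges (star_graph p)"
      using p by (auto simp: edges_star_graph)
    show "homs (star_graph p) G \<subseteq> {q \<in> ?Q. S q \<subseteq> edges G}"
      using that e by (auto simp: homs_def S_def graphs_on_def star_graph_def)
  qed (use fQ in auto)
  \<comment> \<open>If \<open>q 1\<close> equals \<open>q 2\<close> or \<open>q 3\<close>, then
    \<open>S q\<close> contains a singleton, the sum is empty and the bound still holds.\<close>
  have S: "(\<Sum>E\<in>{E\<in>Pow ?V. S q \<subseteq> E}. z ^ card E) \<le> w q * (1 + z) ^ (n choose 2)" for q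
  proof -
    have le: "(\<Sum>E\<in>{E\<in>Pow ?V. S q \<subseteq> E}. z ^ card E) \<le> z ^ card (S q) * (1 + z) ^ (n choose 2)"
      using sum_power_card_supersets_le[OF finite_vertex_pairs z] by (simp add: card_vertex_pairs)
    have "z ^ card (S q) \<le> w q"
      using z by (auto simp: S_def w_def doubleton_eq_iff card_insert_if power2_eq_square)
    with le z show ?thesis
      by (meson add_nonneg_nonneg mult_right_mono order_trans zero_le_one zero_le_power)
  qed
  have "(\<Sum>G\<in>graphs_on n. z ^ card (edges G) * real (card (homs (star_graph p) G)))
      \<le> (\<Sum>G\<in>graphs_on n. z ^ card (edges G) * real (card {q \<in> ?Q. S q \<subseteq> edges G}))"
    by (intro sum_mono mult_left_mono) (use z homs in auto)
  also have "\<dots> = (\<Sum>E\<in>Pow ?V. z ^ card E * real (card {q \<in> ?Q. S q \<subseteq> E}))"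
    by (rule sum_graphs_on)
  also have "\<dots> = (\<Sum>E\<in>Pow ?V. \<Sum>q\<in>?Q. if S q \<subseteq> E then z ^ card E else 0)"
    using fQ by (simp add: sum.inter_filter[symmetric] mult.commute)
  \<comment> \<open>Linearity of expectation: exchanging the sums leaves, for each map, the weight
    of the edge sets containing \<open>S q\<close>.\<close>
  also have "\<dots> = (\<Sum>q\<in>?Q. \<Sum>E\<in>Pow ?V. if S q \<subseteq> E then z ^ card E else 0)"
    by (rule sum.swap)
  also have "\<dots> = (\<Sum>q\<in>?Q. \<Sum>E\<in>{E\<in>Pow ?V. S q \<subseteq> E}. z ^ card E)"
    by (intro sum.cong refl sum.inter_filter[symmetric]) (simp add: finite_vertex_pairs)
  also have "\<dots> \<le> (\<Sum>q\<in>?Q. w q * (1 + z) ^ (n choose 2))"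
    by (intro sum_mono S)
  also have "\<dots> = (1 + z) ^ (n choose 2) * (\<Sum>q\<in>?Q. w q)"
    by (simp add: sum_distrib_left mult.commute)
  also have "(\<Sum>q\<in>?Q. w q) = real n ^ (p + 1) * z ^ 2 + real (card {q \<in> ?Q. q 2 = q 3}) * z"
    using fQ by (simp add: w_def sum.distrib card_PiE sum.inter_filter[symmetric])
  also have "(1 + z) ^ (n choose 2) * \<dots>
      \<le> (1 + z) ^ (n choose 2) * (real n ^ (p + 1) * z ^ 2 + real n ^ p * z)"
    using card_PiE_two_equal_le[OF p, of n] z
    by (intro mult_left_mono add_left_mono mult_right_mono)
      (auto simp flip: of_nat_power intro!: zero_le_power)
  finally show ?thesis .
qed

text \<open>The graph of \<open>exp\<close> lies above its tangent at \<open>m\<close>. Averaging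
  the tangent bound with weights \<open>w\<close> gives at least \<open>exp m\<close>, because
  \<open>m\<close> does not exceed the weighted mean of \<open>f\<close>.\<close>

lemma weighted_Jensen_exp:
  fixes w f :: "'a \<Rightarrow> real"
  assumes w: "\<And>i. i \<in> A \<Longrightarrow> 0 \<le> w i" and m: "m * sum w A \<le> (\<Sum>i\<in>A. w i * f i)"
  shows "sum w A * exp m \<le> (\<Sum>i\<in>A. w i * exp (f i))"
proof -
  have "sum w A * exp m \<le> exp m * ((\<Sum>i\<in>A. w i * f i) + (1 - m) * sum w A)"
    using mult_left_mono[OF m, of "exp m"] by (simp add: algebra_simps)
  also have "\<dots> = (\<Sum>i\<in>A. w i * (exp m * (1 + (f i - m))))"
    by (simp add: algebra_simps sum.distrib sum_subtractf sum_distrib_left)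
  also have "\<dots> \<le> (\<Sum>i\<in>A. w i * exp (f i))"
  proof (intro sum_mono mult_left_mono w)
    fix i
    have "exp m * (1 + (f i - m)) \<le> exp m * exp (f i - m)"
      by (intro mult_left_mono exp_ge_add_one_self) auto
    then show "exp m * (1 + (f i - m)) \<le> exp (f i)"
      by (simp add: exp_add[symmetric])
  qed
  finally show ?thesis .
qed

lemma ln_partition_fun_edge_star_ge:
  assumes p: "2 \<le> p" and n: "n > 0" and b2: "b2 \<le> 0"
  shows "real (n choose 2) * ln (1 + exp (2 * b1))
        + b2 * (real n ^ 2 * exp (2 * b1) ^ 2 + real n * exp (2 * b1))
      \<le> ln (partition_fun edge_graph (star_graph p) b1 b2 n)"
proof -
  define z where "z = exp (2 * b1)"
  define Z where "Z = (1 + z) ^ (n choose 2)"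
  \<comment> \<open>The bracket bounds from above the mean of \<open>n ^ 2\<close> times the star
    density; as \<open>b2 \<le> 0\<close>, \<open>m\<close> is a lower bound for the mean exponent,
    as Jensen's inequality requires.\<close>
  define m where "m = b2 * (real n ^ 2 * z ^ 2 + real n * z)"
  have z: "0 < z" "0 < 1 + z" by (auto simp: z_def add_pos_pos)
  have Z: "(\<Sum>G\<in>graphs_on n. z ^ card (edges G)) = Z" "0 < Z"
    using z by (auto simp: Z_def sum_graphs_on_power_card)
  have "(\<Sum>G\<in>graphs_on n. z ^ card (edges G) * (real n ^ 2 * hom_density (star_graph p) G))
      = real n ^ 2 / real n ^ (p + 1)
        * (\<Sum>G\<in>graphs_on n. z ^ card (edges G) * real (card (homs (star_graph p) G)))"
    unfolding sum_distrib_left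
    by (rule sum.cong) (auto simp: hom_density_def graphs_on_def star_graph_def)
  also have "\<dots> \<le> real n ^ 2 / real n ^ (p + 1)
        * (Z * (real n ^ (p + 1) * z ^ 2 + real n ^ p * z))"
    unfolding Z_def by (intro mult_left_mono sum_power_card_homs_star_le p) (use z in auto)
  also have "\<dots> = (real n ^ 2 * z ^ 2 + real n * z) * Z"
    using n by (simp add: field_simps power2_eq_square)
  finally have "m * Z \<le> b2 *
      (\<Sum>G\<in>graphs_on n. z ^ card (edges G) * (real n ^ 2 * hom_density (star_graph p) G))"
    unfolding m_def mult.assoc using b2 by (rule mult_left_mono_neg)
  then have "Z * exp m \<le> partition_fun edge_graph (star_graph p) b1 b2 n"
    unfolding partition_fun_edge[OF n] z_def[symmetric] Z(1)[symmetric]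
    by (intro weighted_Jensen_exp) (use z in \<open>auto simp: sum_distrib_left mult_ac\<close>)
  then have "ln (Z * exp m) \<le> ln (partition_fun edge_graph (star_graph p) b1 b2 n)"
    using Z by (intro ln_mono) auto
  moreover have "ln (Z * exp m) = real (n choose 2) * ln (1 + z) + m"
    using Z z by (simp add: ln_mult Z_def ln_realpow)
  ultimately show ?thesis by (simp add: m_def z_def)
qed

section \<open>Limits\<close>

text \<open>The lower comparison sequence for both limits: the fraction is
  \<open>(n choose 2) / n ^ 2\<close>, the factor \<open>1 - z n\<close> comes from bounding
  \<open>ln (1 + z n)\<close>, and \<open>d\<close> is the relative cost of the stars.\<close>

lemma tendsto_ln_rate_lower:
  fixes z d :: "nat \<Rightarrow> real"
  assumes "z \<longlonglongrightarrow> 0" "d \<longlonglongrightarrow> 0"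
  shows "(\<lambda>n. (real n - 1) / (2 * real n) * (1 - z n) + d n) \<longlonglongrightarrow> 1 / 2"
proof -
  have "(\<lambda>n. (real n - 1) / (2 * real n)) \<longlonglongrightarrow> 1 / 2" by real_asymp
  then have "(\<lambda>n. (real n - 1) / (2 * real n) * (1 - z n) + d n) \<longlonglongrightarrow> 1 / 2 * (1 - 0) + 0"
    by (intro tendsto_add tendsto_mult tendsto_diff tendsto_const assms)
  then show ?thesis by simp
qed

text \<open>From \<open>ln (1 + z) \<ge> z - z ^ 2\<close> on the unit interval.\<close>

lemma choose_two_ln_ge:
  assumes "0 \<le> z" "z \<le> 1"
  shows "real n ^ 2 * z * ((real n - 1) / (2 * real n) * (1 - z)) \<le> real (n choose 2) * ln (1 + z)"
proof -
  have "real n ^ 2 * z * ((real n - 1) / (2 * real n) * (1 - z))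
      = real (n choose 2) * (z - z ^ 2)"
    by (cases "n = 0") (auto simp: real_choose_two field_simps power2_eq_square)
  also have "\<dots> \<le> real (n choose 2) * ln (1 + z)"
    by (intro mult_left_mono ln_one_plus_pos_lower_bound assms) auto
  finally show ?thesis .
qed

text \<open>Eventually the logarithmic and exponential factors are at least 1 and
  \<open>\<alpha> n powr (1 / 5) \<le> \<alpha> n powr (8 / 5)\<close>. This squeezes the fifth root
  of \<open>\<alpha> n / n\<close> to 0; then take fifth powers.\<close>

lemma tendsto_div_of_growth_condition:
  fixes \<alpha> :: "nat \<Rightarrow> real"
  assumes \<alpha>: "filterlim \<alpha> at_top sequentially" and c: "0 \<le> c"
    and lim: "(\<lambda>n. \<alpha> n powr (8 / 5) * ln (real n) powr (1 / 5) * exp (2 * \<alpha> n * c)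
            / real n powr (1 / 5)) \<longlonglongrightarrow> 0"
  shows "(\<lambda>n. \<alpha> n / real n) \<longlonglongrightarrow> 0"
proof -
  have ln1: "\<forall>\<^sub>F n in sequentially. 1 \<le> ln (real n)" by real_asymp
  have \<alpha>1: "\<forall>\<^sub>F n in sequentially. 1 \<le> \<alpha> n"
    using \<alpha> by (simp add: filterlim_at_top)
  have root: "(\<lambda>n. (\<alpha> n / real n) powr (1 / 5)) \<longlonglongrightarrow> 0"
  proof (rule tendsto_sandwich[OF _ _ tendsto_const lim])
    show "\<forall>\<^sub>F n in sequentially. (\<alpha> n / real n) powr (1 / 5)
        \<le> \<alpha> n powr (8 / 5) * ln (real n) powr (1 / 5) * exp (2 * \<alpha> n * c) / real n powr (1 / 5)"
      using ln1 \<alpha>1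
    proof eventually_elim
      case (elim n)
      have "1 \<le> ln (real n) powr (1 / 5)" "\<alpha> n powr (1 / 5) \<le> \<alpha> n powr (8 / 5)"
        "1 \<le> exp (2 * \<alpha> n * c)"
        using elim c by (auto intro: ge_one_powr_ge_zero powr_mono)
      then have "\<alpha> n powr (1 / 5) * 1 * 1
          \<le> \<alpha> n powr (8 / 5) * ln (real n) powr (1 / 5) * exp (2 * \<alpha> n * c)"
        by (intro mult_mono) auto
      then show ?case
        using elim by (simp add: powr_divide divide_right_mono)
    qed
  qed auto
  have "(\<lambda>n. ((\<alpha> n / real n) powr (1 / 5)) ^ 5) \<longlonglongrightarrow> 0 ^ 5"
    by (rule tendsto_power[OF root])
  moreover have "\<forall>\<^sub>F n in sequentially. ((\<alpha> n / real n) powr (1 / 5)) ^ 5 = \<alpha> n / real n"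
    using \<alpha>1 eventually_gt_at_top[of 0]
    by eventually_elim (simp add: powr_power)
  ultimately show ?thesis
    by (simp add: tendsto_cong)
qed

theorem theorem2p3:
  fixes p :: nat and \<beta>1 \<beta>2 :: real and \<alpha> :: "nat \<Rightarrow> real"
  assumes "p \<ge> 2" and "\<beta>1 < 0" and "\<beta>2 < 0"
    and "filterlim \<alpha> at_top sequentially"
  shows "((\<lambda>n. variational_sup edge_graph (star_graph p) (\<alpha> n * \<beta>1) (\<alpha> n * \<beta>2) n
            / exp (2 * \<alpha> n * \<beta>1)) \<longlonglongrightarrow> 1 / 2) \<and>
         (((\<lambda>n. \<alpha> n powr (8 / 5) * ln (real n) powr (1 / 5) * exp (2 * \<alpha> n * \<bar>\<beta>1\<bar>)
            / real n powr (1 / 5)) \<longlonglongrightarrow> 0) \<longrightarrow>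
          ((\<lambda>n. ln (partition_fun edge_graph (star_graph p) (\<alpha> n * \<beta>1) (\<alpha> n * \<beta>2) n)
            / (real n ^ 2 * exp (2 * \<alpha> n * \<beta>1))) \<longlonglongrightarrow> 1 / 2))"
proof -
  define z where "z n = exp (2 * \<alpha> n * \<beta>1)" for n
  have zpos: "0 < z n" for n by (simp add: z_def)
  have zexp: "exp (2 * (\<alpha> n * \<beta>1)) = z n" for n by (simp add: z_def mult.assoc)
  have "((\<lambda>y. exp (2 * y * \<beta>1)) \<longlongrightarrow> 0) at_top"
    using assms(2) by real_asymp
  then have z0: "z \<longlonglongrightarrow> 0"
    unfolding z_def using assms(4) by (rule filterlim_compose)
  \<comment> \<open>Exponential decay beats the linear factor, so the \<open>z ^ 2\<close> part of
    the star density is negligible relative to \<open>z\<close>.\<close>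
  have "((\<lambda>y. \<beta>2 * y * exp (2 * y * \<beta>1)) \<longlongrightarrow> 0) at_top"
    using assms(2,3) by real_asymp
  then have \<alpha>z0: "(\<lambda>n. \<beta>2 * \<alpha> n * z n) \<longlonglongrightarrow> 0"
    unfolding z_def using assms(4) by (rule filterlim_compose)
  have pos: "\<forall>\<^sub>F n in sequentially. 0 \<le> \<alpha> n"
    using assms(4) by (simp add: filterlim_at_top)
  have ev: "\<forall>\<^sub>F n in sequentially. n > 0 \<and> \<alpha> n * \<beta>2 \<le> 0 \<and> z n \<le> 1"
    using pos eventually_gt_at_top[of 0]
    by eventually_elim (use assms in \<open>auto simp: z_def mult_nonneg_nonpos\<close>)
  have "(\<lambda>n. variational_sup edge_graph (star_graph p) (\<alpha> n * \<beta>1) (\<alpha> n * \<beta>2) n / z n)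
      \<longlonglongrightarrow> 1 / 2"
  \<comment> \<open>Dividing the star term \<open>\<alpha> n * \<beta>2 * z n ^ 2\<close> by
    \<open>z n\<close> leaves \<open>\<beta>2 * \<alpha> n * z n\<close> as the error
    \<open>d\<close>.\<close>
  proof (rule tendsto_sandwich[OF _ _ tendsto_ln_rate_lower[OF z0 \<alpha>z0] tendsto_const])
    show "\<forall>\<^sub>F n in sequentially. (real n - 1) / (2 * real n) * (1 - z n) + \<beta>2 * \<alpha> n * z n
        \<le> variational_sup edge_graph (star_graph p) (\<alpha> n * \<beta>1) (\<alpha> n * \<beta>2) n / z n"
      using ev
    proof eventually_elim
      case (elim n)
      have "z n * ((real n - 1) / (2 * real n) * (1 - z n))
          \<le> real (n choose 2) / real n ^ 2 * ln (1 + z n)"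
        using choose_two_ln_ge[of "z n" n] zpos[of n] elim
        by (simp add: pos_le_divide_eq mult_ac)
      moreover have "real (n choose 2) / real n ^ 2 * ln (1 + z n) + \<alpha> n * \<beta>2 * z n ^ 2
          \<le> variational_sup edge_graph (star_graph p) (\<alpha> n * \<beta>1) (\<alpha> n * \<beta>2) n"
        using variational_sup_edge_ge[OF simple_graph_star_graph, of p "\<alpha> n * \<beta>2" n "\<alpha> n * \<beta>1"]
          elim assms(1)
        by (simp only: card_edges_star_graph zexp)
      ultimately show ?case
        using zpos[of n] by (simp add: pos_le_divide_eq algebra_simps power2_eq_square)
    qed
    show "\<forall>\<^sub>F n in sequentially.
        variational_sup edge_graph (star_graph p) (\<alpha> n * \<beta>1) (\<alpha> n * \<beta>2) n / z n \<le> 1 / 2"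
      using ev
    proof eventually_elim
      case (elim n)
      then show ?case
        using variational_sup_edge_le[OF simple_graph_star_graph, of "\<alpha> n * \<beta>2" p "\<alpha> n * \<beta>1" n]
          zpos[of n]
        by (simp add: zexp pos_divide_le_eq)
    qed
  qed
  moreover have "(\<lambda>n. ln (partition_fun edge_graph (star_graph p) (\<alpha> n * \<beta>1) (\<alpha> n * \<beta>2) n)
            / (real n ^ 2 * z n)) \<longlonglongrightarrow> 1 / 2"
    if "(\<lambda>n. \<alpha> n powr (8 / 5) * ln (real n) powr (1 / 5) * exp (2 * \<alpha> n * \<bar>\<beta>1\<bar>)
            / real n powr (1 / 5)) \<longlonglongrightarrow> 0"
  proof -
    \<comment> \<open>The extra term \<open>\<beta>2 * (\<alpha> n / n)\<close> stems from maps
      sending two leaves to the same vertex; the growth condition removes it.\<close>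
    have "(\<lambda>n. \<beta>2 * \<alpha> n * z n + \<beta>2 * (\<alpha> n / real n)) \<longlonglongrightarrow> 0 + \<beta>2 * 0"
      by (intro tendsto_intros \<alpha>z0 tendsto_div_of_growth_condition[OF assms(4) _ that]) auto
    then have d0: "(\<lambda>n. \<beta>2 * \<alpha> n * z n + \<beta>2 * (\<alpha> n / real n)) \<longlonglongrightarrow> 0" by simp
    show ?thesis
    proof (rule tendsto_sandwich[OF _ _ tendsto_ln_rate_lower[OF z0 d0] tendsto_const])
      show "\<forall>\<^sub>F n in sequentially. (real n - 1) / (2 * real n) * (1 - z n)
            + (\<beta>2 * \<alpha> n * z n + \<beta>2 * (\<alpha> n / real n))
          \<le> ln (partition_fun edge_graph (star_graph p) (\<alpha> n * \<beta>1) (\<alpha> n * \<beta>2) n)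
            / (real n ^ 2 * z n)"
        using ev
      proof eventually_elim
        case (elim n)
        let ?r = "(real n - 1) / (2 * real n) * (1 - z n)"
        \<comment> \<open>Clearing the denominator \<open>n ^ 2 * z n\<close> turns the relative
          errors into exactly the star term of the Jensen bound.\<close>
        have "(?r + (\<beta>2 * \<alpha> n * z n + \<beta>2 * (\<alpha> n / real n))) * (real n ^ 2 * z n)
            = real n ^ 2 * z n * ?r + \<alpha> n * \<beta>2 * (real n ^ 2 * z n ^ 2 + real n * z n)"
          using elim by (simp add: field_simps power2_eq_square)
        also have "\<dots> \<le> real (n choose 2) * ln (1 + z n)
            + \<alpha> n * \<beta>2 * (real n ^ 2 * z n ^ 2 + real n * z n)"
          using choose_two_ln_ge[of "z n" n] zpos[of n] elim by simp
        also have "\<dots> \<le> ln (partition_fun edge_graph (star_graph p) (\<alpha> n * \<beta>1) (\<alpha> n * \<beta>2) n)"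
          using ln_partition_fun_edge_star_ge[OF assms(1), of n "\<alpha> n * \<beta>2" "\<alpha> n * \<beta>1"] elim
          by (simp only: zexp)
        finally show ?case
          using zpos[of n] elim by (simp add: pos_le_divide_eq)
      qed
      show "\<forall>\<^sub>F n in sequentially.
          ln (partition_fun edge_graph (star_graph p) (\<alpha> n * \<beta>1) (\<alpha> n * \<beta>2) n)
            / (real n ^ 2 * z n) \<le> 1 / 2"
        using ev
      proof eventually_elim
        case (elim n)
        then show ?case
          using ln_partition_fun_edge_le[of n "\<alpha> n * \<beta>2" "star_graph p" "\<alpha> n * \<beta>1"] zpos[of n]
          by (simp add: zexp pos_divide_le_eq)
      qed
    qed
  qed
  ultimately show ?thesis by (simp add: z_def)
qed

end
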